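(* For every integer $N\ge 3$, the first three Ritz levels satisfy $$\Lambda_1(N)=2N,\qquad \Lambda_2(N)=3N-\sqrt{N^2+8N-8},$$ and, with $$R_N:=\sqrt{N^2+11N-20},\qquad \phi_N:=\frac13\arccos\left(\frac{3\sqrt3\,N(7N-16)}{2R_N^3}\right),$$ $$\Lambda_3(N)=4N+\frac{4R_N}{\sqrt3}\cos\left(\phi_N+\frac{2\pi}{3}\right).$$ Equivalently, $\Lambda_3(N)$ is the smallest zero of $$\lambda^3-12N\lambda^2+(44N^2-44N+80)\lambda-48N^3+120N^2-192N=0.$$ Moreover $\Lambda_2(N)<2N$ for all $N\ge3$, and $$\Lambda_1(N)<A_N\quad(N\ge12),$$ $$\Lambda_2(10)>A_{10},\qquad \Lambda_2(N)<A_N\quad(N\ge 11),$$ $$\Lambda_3(10)<A_{10}.$$ Consequently, $$C(N)\le\Lambda_2(N)<\min\{A_N,2N\}\qquad(N\ge 11),$$ and $C(10)<A_{10}$. Finally, $$\Lambda_3(N)=2N-4-\frac6N+\frac{51}{N^2}+O(N^{-3})\qquad(N\to\infty).$$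
   Context: For integers $1\le k\le N$, $M_N^{(k)}$ is the $k\times k$ real symmetric tridiagonal matrix with $(M_N^{(k)})_{jj}=2Nj$ for $1\le j\le k$ and $(M_N^{(k)})_{j,j+1}=(M_N^{(k)})_{j+1,j}=-(j+1)\sqrt{2j(N-j)}$ for $1\le j<k$; $\Lambda_k(N):=\lambda_{\min}(M_N^{(k)})$ is its smallest eigenvalue. Put $A_N=(N-2)^2/4$. For finitely supported $u:\mathbb Z^N\to\mathbb C$ with $u(0)=0$ let $$\mathcal E_N[u]=\sum_{j=1}^N\sum_{n\in\mathbb Z^N}|u(n+e_j)-u(n)|^2,\qquad \mathcal D_N[u]=\sum_{n\ne0}\frac{|u(n)|^2}{|n|^2},$$ with $e_j$ the standard basis and $|n|$ the Euclidean norm; $C(N)$ is the infimum of $\mathcal E_N[u]/\mathcal D_N[u]$ over all such $u\ne0$. *)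

theory Defs
  imports
    "Jordan_Normal_Form.Char_Poly"
    "HOL-Analysis.L2_Norm"
    "HOL-Analysis.Infinite_Sum"
    "HOL-Library.Landau_Symbols"
begin

text \<open>The argument \<open>k\<close> is the size of the matrix. Entries of \<^const>\<open>mat\<close> are counted
  from \<open>0\<close>; \<open>ritz_entry\<close> uses row and column indices counted from \<open>1\<close>.\<close>

definition ritz_offdiag :: "nat \<Rightarrow> nat \<Rightarrow> real" where
  "ritz_offdiag N j = - (real j + 1) * sqrt (2 * real j * (real N - real j))"

definition ritz_entry :: "nat \<Rightarrow> nat \<Rightarrow> nat \<Rightarrow> real" where
  "ritz_entry N r c =
     (if r = c then 2 * real N * real r
      else if c = r + 1 then ritz_offdiag N r
      else if r = c + 1 then ritz_offdiag N c
      else 0)"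

definition ritz_matrix :: "nat \<Rightarrow> nat \<Rightarrow> real mat" where
  "ritz_matrix k N = mat k k (\<lambda>(r, c). ritz_entry N (r + 1) (c + 1))"

definition ritz_level :: "nat \<Rightarrow> nat \<Rightarrow> real" where
  "ritz_level k N = Min {x. eigenvalue (ritz_matrix k N) x}"

definition A_const :: "nat \<Rightarrow> real" where
  "A_const N = (real N - 2)\<^sup>2 / 4"

text \<open>The lattice of integer vectors of dimension \<open>N\<close> is encoded by the integer sequences
  vanishing outside the index set \<open>{1..N}\<close>, because \<open>N\<close> varies inside the statement.\<close>

definition int_lattice :: "nat \<Rightarrow> (nat \<Rightarrow> int) set" where
  "int_lattice N = {n. \<forall>i. i \<notin> {1..N} \<longrightarrow> n i = 0}"

definition lattice_zero :: "nat \<Rightarrow> int" where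
  "lattice_zero = (\<lambda>_. 0)"

definition lattice_unit :: "nat \<Rightarrow> nat \<Rightarrow> int" where
  "lattice_unit j = (\<lambda>i. if i = j then 1 else 0)"

definition lattice_add :: "(nat \<Rightarrow> int) \<Rightarrow> (nat \<Rightarrow> int) \<Rightarrow> nat \<Rightarrow> int" where
  "lattice_add m n = (\<lambda>i. m i + n i)"

definition lattice_norm :: "nat \<Rightarrow> (nat \<Rightarrow> int) \<Rightarrow> real" where
  "lattice_norm N n = L2_set (\<lambda>i. real_of_int (n i)) {1..N}"

definition hardy_energy :: "nat \<Rightarrow> ((nat \<Rightarrow> int) \<Rightarrow> complex) \<Rightarrow> real" where
  "hardy_energy N u =
     (\<Sum>j\<in>{1..N}. \<Sum>\<^sub>\<infinity>n\<in>int_lattice N. (cmod (u (lattice_add n (lattice_unit j)) - u n))\<^sup>2)"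

definition hardy_weight :: "nat \<Rightarrow> ((nat \<Rightarrow> int) \<Rightarrow> complex) \<Rightarrow> real" where
  "hardy_weight N u =
     (\<Sum>\<^sub>\<infinity>n\<in>int_lattice N - {lattice_zero}. (cmod (u n))\<^sup>2 / (lattice_norm N n)\<^sup>2)"

text \<open>A function on the lattice is extended by zero to all integer sequences; so \<open>u\<close> is
  nonzero on the lattice iff it is not the zero function.\<close>

definition hardy_admissible :: "nat \<Rightarrow> ((nat \<Rightarrow> int) \<Rightarrow> complex) set" where
  "hardy_admissible N =
     {u. {n. u n \<noteq> 0} \<subseteq> int_lattice N \<and> finite {n. u n \<noteq> 0} \<and>
         u lattice_zero = 0 \<and> u \<noteq> (\<lambda>_. 0)}"

definition hardy_const :: "nat \<Rightarrow> real" where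
  "hardy_const N = (INF u\<in>hardy_admissible N. hardy_energy N u / hardy_weight N u)"

definition R_const :: "nat \<Rightarrow> real" where
  "R_const N = sqrt ((real N)\<^sup>2 + 11 * real N - 20)"

definition phi_const :: "nat \<Rightarrow> real" where
  "phi_const N =
     1 / 3 * arccos (3 * sqrt 3 * real N * (7 * real N - 16) / (2 * R_const N ^ 3))"

definition ritz_cubic :: "nat \<Rightarrow> real \<Rightarrow> real" where
  "ritz_cubic N x =
     x ^ 3 - 12 * real N * x\<^sup>2 + (44 * (real N)\<^sup>2 - 44 * real N + 80) * x
       - 48 * real N ^ 3 + 120 * (real N)\<^sup>2 - 192 * real N"

end

theory Submission
  imports Defs "HOL-Real_Asymp.Real_Asymp"
begin

text \<open>The Ritz matrix is the Hardy quotient restricted to trial functions that live on the cube of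
  vectors with entries \<open>-1, 0, 1\<close> and depend only on the number \<open>j\<close> of nonzero entries, with
  \<open>1 \<le> j \<le> k\<close>. For such a function the discrete Laplacian at a point of layer \<open>j\<close> involves only the
  layers \<open>j - 1\<close>, \<open>j\<close> and \<open>j + 1\<close>, and \<open>|n|\<^sup>2 = j\<close>. After a diagonal rescaling the resulting
  three-term equation is the eigenvector equation of the Ritz matrix. An eigenvector therefore yields
  a function that satisfies the Euler--Lagrange equation of the Hardy quotient wherever it is nonzero,
  and summation by parts shows that its quotient equals the eigenvalue. This is
  \<open>hardy_const_le_ritz_eigenvalue\<close>.

  The levels themselves are roots of characteristic polynomials of degree one, two and three. The cubic,
  centred at \<open>4 * N\<close>, has no square term, and the triple angle formula for the cosine solves it. That
  the given angle produces the smallest root follows from the monotonicity of \<open>4 * e ^ 3 - 3 * e\<close>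
  for \<open>e \<le> -1/2\<close> (\<open>trig_cubic_smallest_root\<close>). The comparisons with \<open>A_const\<close> are elementary
  estimates of square roots, and a sign change of the cubic for \<open>N = 10\<close>.

  For the expansion, the proposed approximation leaves a residual of order \<open>1 / N\<close> in the cubic, and the
  secant slope of the cubic between the approximation and the root is at least \<open>N\<^sup>2\<close> for large \<open>N\<close>;
  their quotient bounds the error.\<close>

section \<open>Summation by parts and eigenfunctions on the lattice\<close>

lemma infsum_finite_support:
  fixes h :: "'a \<Rightarrow> real"
  assumes "finite Q" "Q \<subseteq> P" "\<And>n. n \<in> P - Q \<Longrightarrow> h n = 0"
  shows "infsum h P = sum h Q" and "h summable_on P"
proof -
  have "infsum h P = infsum h Q"
    using assms by (intro infsum_cong_neutral) auto
  then show "infsum h P = sum h Q" using assms by simp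
  have "h summable_on Q \<longleftrightarrow> h summable_on P"
    using assms by (intro summable_on_cong_neutral) auto
  then show "h summable_on P" using assms by simp
qed

definition lattice_sub :: "(nat \<Rightarrow> int) \<Rightarrow> (nat \<Rightarrow> int) \<Rightarrow> nat \<Rightarrow> int" where
  "lattice_sub m n = (\<lambda>i. m i - n i)"

lemma lattice_shift_bij:
  assumes "j \<in> {1..N}"
  shows "bij_betw (\<lambda>n. lattice_add n (lattice_unit j)) (int_lattice N) (int_lattice N)"
  by (rule bij_betw_byWitness[where f' = "\<lambda>n. lattice_sub n (lattice_unit j)"])
     (use assms in \<open>auto simp: lattice_add_def lattice_sub_def int_lattice_def lattice_unit_def\<close>)

text \<open>Expand the square as \<open>g (n + e) * (g (n + e) - g n) + g n * (g n - g (n + e))\<close> and shift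
  the lattice by \<open>-e\<close> in the first product. The energy becomes a sum over the support of \<open>g\<close>
  against the discrete Laplacian, so that it can be evaluated pointwise.\<close>
lemma summation_by_parts:
  fixes g :: "(nat \<Rightarrow> int) \<Rightarrow> real"
  assumes fin: "finite Q" and QP: "Q \<subseteq> int_lattice N" and supp: "\<And>n. n \<notin> Q \<Longrightarrow> g n = 0"
    and j: "j \<in> {1..N}"
  shows "(\<Sum>\<^sub>\<infinity>n\<in>int_lattice N. (g (lattice_add n (lattice_unit j)) - g n)\<^sup>2)
       = (\<Sum>n\<in>Q. g n * (2 * g n - g (lattice_add n (lattice_unit j))
                                 - g (lattice_sub n (lattice_unit j))))"
proof -
  define P where "P = int_lattice N"
  define T where "T n = lattice_add n (lattice_unit j)" for n
  define S where "S n = lattice_sub n (lattice_unit j)" for n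
  have ST: "S (T n) = n" for n
    by (simp add: S_def T_def lattice_add_def lattice_sub_def)
  have bij: "bij_betw T P P"
    using lattice_shift_bij[OF j] unfolding T_def P_def .
  define h where "h n = g n * (g n - g (S n))" for n
  define l where "l n = g n * (g n - g (T n))" for n
  have h0: "h n = 0" "l n = 0" if "n \<in> P - Q" for n
    using supp that by (auto simp: h_def l_def)
  note fh = infsum_finite_support[OF fin QP[folded P_def] h0(1)]
  note fl = infsum_finite_support[OF fin QP[folded P_def] h0(2)]
  have sT: "(\<lambda>n. h (T n)) summable_on P"
    using summable_on_reindex_bij_betw[OF bij, of h] fh(2) by simp
  have "(\<Sum>\<^sub>\<infinity>n\<in>P. (g (T n) - g n)\<^sup>2) = (\<Sum>\<^sub>\<infinity>n\<in>P. h (T n) + l n)"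
    by (intro infsum_cong) (simp add: h_def l_def ST power2_eq_square algebra_simps)
  also have "\<dots> = (\<Sum>\<^sub>\<infinity>n\<in>P. h (T n)) + infsum l P"
    by (rule infsum_add[OF sT fl(2)])
  also have "(\<Sum>\<^sub>\<infinity>n\<in>P. h (T n)) = infsum h P"
    by (rule infsum_reindex_bij_betw[OF bij])
  also have "infsum h P + infsum l P = (\<Sum>n\<in>Q. h n + l n)"
    using fh(1) fl(1) by (simp add: sum.distrib)
  also have "\<dots> = (\<Sum>n\<in>Q. g n * (2 * g n - g (T n) - g (S n)))"
    by (intro sum.cong) (simp_all add: h_def l_def algebra_simps)
  finally show ?thesis unfolding T_def S_def P_def .
qed

lemma hardy_energy_nonneg: "hardy_energy N u \<ge> 0"
  unfolding hardy_energy_def by (intro sum_nonneg infsum_nonneg) auto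

lemma hardy_weight_nonneg: "hardy_weight N u \<ge> 0"
  unfolding hardy_weight_def by (intro infsum_nonneg) auto

text \<open>Only the points where \<open>g\<close> does not vanish enter the equation, because after summation by parts
  the Laplacian is paired with \<open>g\<close> itself. Hence \<open>g\<close> may violate the equation outside its support,
  and truncated trial functions qualify: their Rayleigh quotient is exactly \<open>x\<close>.\<close>
lemma hardy_const_le_of_eigenfunction:
  fixes g :: "(nat \<Rightarrow> int) \<Rightarrow> real"
  assumes fin: "finite {n. g n \<noteq> 0}" and P: "{n. g n \<noteq> 0} \<subseteq> int_lattice N"
    and zero: "g lattice_zero = 0" and nz: "g m \<noteq> 0"
    and eq: "\<And>n. g n \<noteq> 0 \<Longrightarrow>
       2 * real N * g n - (\<Sum>j\<in>{1..N}. g (lattice_add n (lattice_unit j))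
                                   + g (lattice_sub n (lattice_unit j)))
       = x * (g n / (lattice_norm N n)\<^sup>2)"
  shows "hardy_const N \<le> x"
proof -
  define Q where "Q = {n. g n \<noteq> 0}"
  define u where "u n = complex_of_real (g n)" for n
  have sq: "(cmod (u a - u b))\<^sup>2 = (g a - g b)\<^sup>2" for a b
    unfolding u_def by (metis norm_of_real of_real_diff power2_abs)
  have "hardy_energy N u = (\<Sum>j\<in>{1..N}. \<Sum>n\<in>Q. g n * (2 * g n - g (lattice_add n (lattice_unit j))
                                 - g (lattice_sub n (lattice_unit j))))"
    unfolding hardy_energy_def sq
    by (intro sum.cong refl summation_by_parts) (use fin P in \<open>auto simp: Q_def\<close>)
  also have "\<dots> = (\<Sum>n\<in>Q. g n * (2 * real N * g n - (\<Sum>j\<in>{1..N}. g (lattice_add n (lattice_unit j))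
                                   + g (lattice_sub n (lattice_unit j)))))"
    by (subst sum.swap)
       (auto intro!: sum.cong simp: sum_distrib_left[symmetric] sum_subtractf sum.distrib algebra_simps)
  also have "\<dots> = (\<Sum>n\<in>Q. g n * (x * (g n / (lattice_norm N n)\<^sup>2)))"
    by (intro sum.cong refl) (use eq in \<open>auto simp: Q_def\<close>)
  also have "\<dots> = x * (\<Sum>n\<in>Q. (g n)\<^sup>2 / (lattice_norm N n)\<^sup>2)"
    by (auto simp: sum_distrib_left power2_eq_square intro!: sum.cong)
  finally have E: "hardy_energy N u = x * (\<Sum>n\<in>Q. (g n)\<^sup>2 / (lattice_norm N n)\<^sup>2)" .
  have D: "hardy_weight N u = (\<Sum>n\<in>Q. (g n)\<^sup>2 / (lattice_norm N n)\<^sup>2)"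
    unfolding hardy_weight_def u_def norm_of_real power2_abs
    by (rule infsum_finite_support(1)) (use fin P zero in \<open>auto simp: Q_def\<close>)
  have norm_pos: "(lattice_norm N n)\<^sup>2 > 0" if "n \<in> Q" for n
  proof -
    have "n \<noteq> lattice_zero" "n \<in> int_lattice N" using that P zero by (auto simp: Q_def)
    then obtain i where "i \<in> {1..N}" "n i \<noteq> 0"
      by (auto simp: int_lattice_def lattice_zero_def fun_eq_iff)
    then show ?thesis
      by (auto simp: lattice_norm_def L2_set_eq_0_iff)
  qed
  have Dpos: "hardy_weight N u > 0"
    unfolding D
  proof (rule sum_pos)
    show "finite Q" "Q \<noteq> {}" using fin nz by (auto simp: Q_def)
    show "0 < (g n)\<^sup>2 / (lattice_norm N n)\<^sup>2" if "n \<in> Q" for n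
      using norm_pos[OF that] that by (auto simp: Q_def)
  qed
  have adm: "u \<in> hardy_admissible N"
    using fin P zero nz unfolding hardy_admissible_def u_def by (auto simp: fun_eq_iff)
  have "bdd_below ((\<lambda>u. hardy_energy N u / hardy_weight N u) ` hardy_admissible N)"
    by (rule bdd_belowI2[of _ 0])
       (simp add: hardy_energy_nonneg hardy_weight_nonneg)
  then have "hardy_const N \<le> hardy_energy N u / hardy_weight N u"
    unfolding hardy_const_def using adm by (intro cINF_lower)
  also have "\<dots> = x" using Dpos E D by simp
  finally show ?thesis .
qed

section \<open>Trial functions on the layers of the cube\<close>

definition ternary_cube :: "nat \<Rightarrow> (nat \<Rightarrow> int) set" where
  "ternary_cube N = {n \<in> int_lattice N. \<forall>i. n i \<in> {-1, 0, 1}}"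

definition layer :: "nat \<Rightarrow> (nat \<Rightarrow> int) \<Rightarrow> nat" where
  "layer N n = card {i \<in> {1..N}. n i \<noteq> 0}"

definition layer_fun :: "nat \<Rightarrow> (nat \<Rightarrow> real) \<Rightarrow> (nat \<Rightarrow> int) \<Rightarrow> real" where
  "layer_fun N a n = (if n \<in> ternary_cube N then a (layer N n) else 0)"

lemma finite_ternary_cube: "finite (ternary_cube N)"
proof (rule finite_subset)
  show "ternary_cube N \<subseteq> {f. \<forall>x. (x \<in> {1..N} \<longrightarrow> f x \<in> {-1, 0, 1}) \<and> (x \<notin> {1..N} \<longrightarrow> f x = 0)}"
    by (auto simp: ternary_cube_def int_lattice_def)
  show "finite {f. \<forall>x. (x \<in> {1..N} \<longrightarrow> f x \<in> {-1, 0, 1 :: int}) \<and> (x \<notin> {1..N} \<longrightarrow> f x = 0)}"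
    by (rule finite_set_of_finite_funs) auto
qed

lemma lattice_norm_ternary:
  assumes "n \<in> ternary_cube N"
  shows "(lattice_norm N n)\<^sup>2 = real (layer N n)"
proof -
  have "(lattice_norm N n)\<^sup>2 = (\<Sum>i\<in>{1..N}. (real_of_int (n i))\<^sup>2)"
    unfolding lattice_norm_def L2_set_def by (simp add: sum_nonneg)
  also have "\<dots> = (\<Sum>i\<in>{1..N}. if n i \<noteq> 0 then 1 else 0)"
    by (intro sum.cong refl) (use assms in \<open>force simp: ternary_cube_def\<close>)
  also have "\<dots> = real (layer N n)"
    by (simp add: layer_def sum.If_cases Int_def)
  finally show ?thesis .
qed

text \<open>At a zero coordinate both neighbours lie one layer higher. At a coordinate \<open>1\<close> or \<open>-1\<close> one
  neighbour lies one layer lower and the other has the coordinate \<open>2\<close> or \<open>-2\<close>, so it is outside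
  the cube.\<close>
lemma layer_fun_neighbours:
  assumes n: "n \<in> ternary_cube N" and j: "j \<in> {1..N}"
  shows "layer_fun N a (lattice_add n (lattice_unit j)) + layer_fun N a (lattice_sub n (lattice_unit j))
       = (if n j = 0 then 2 * a (layer N n + 1) else a (layer N n - 1))"
proof -
  have add: "lattice_add n (lattice_unit j) = n(j := n j + 1)"
    and sub: "lattice_sub n (lattice_unit j) = n(j := n j - 1)"
    by (auto simp: lattice_add_def lattice_sub_def lattice_unit_def)
  have mem: "n(j := c) \<in> ternary_cube N \<longleftrightarrow> c \<in> {-1, 0, 1}" for c
    using n j by (auto simp: ternary_cube_def int_lattice_def)
  have up: "layer N (n(j := c)) = layer N n + 1" if "n j = 0" "c \<noteq> 0" for c
  proof -
    have "{i \<in> {1..N}. (n(j := c)) i \<noteq> 0} = insert j {i \<in> {1..N}. n i \<noteq> 0}"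
      using that j by auto
    then show ?thesis using that by (simp add: layer_def)
  qed
  have down: "layer N (n(j := 0)) = layer N n - 1" if "n j \<noteq> 0"
  proof -
    have "{i \<in> {1..N}. (n(j := 0)) i \<noteq> 0} = {i \<in> {1..N}. n i \<noteq> 0} - {j}"
      using that j by auto
    then show ?thesis using that j by (simp add: layer_def)
  qed
  have "n j \<in> {-1, 0, 1}" using n by (simp add: ternary_cube_def)
  then consider "n j = -1" | "n j = 0" | "n j = 1" by blast
  then show ?thesis
    by cases (use up down in \<open>simp_all add: add sub layer_fun_def mem\<close>)
qed

text \<open>A point of layer \<open>j\<close> has \<open>N - j\<close> zero coordinates, \<open>j\<close> nonzero ones and squared norm \<open>j\<close>.
  By the count of neighbours, the eigenfunction equation on layer \<open>j\<close> is the three-term equation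
  assumed here.\<close>
lemma hardy_const_le_of_layer_eigenvector:
  fixes a :: "nat \<Rightarrow> real"
  assumes kN: "k \<le> N" and a0: "a 0 = 0" and ak: "\<And>j. j > k \<Longrightarrow> a j = 0" and m: "a m \<noteq> 0"
    and eq: "\<And>j. 1 \<le> j \<Longrightarrow> j \<le> k \<Longrightarrow>
      2 * real N * a j - real j * a (j - 1) - 2 * (real N - real j) * a (j + 1) = x * (a j / real j)"
  shows "hardy_const N \<le> x"
proof -
  define g where "g = layer_fun N a"
  define p where "p i = (if i \<in> {1..m} then 1 else 0 :: int)" for i
  have mk: "1 \<le> m" "m \<le> k" using a0 ak m by (metis One_nat_def Suc_leI gr0I, metis not_le)
  have "{i \<in> {1..N}. p i \<noteq> 0} = {1..m}" using mk kN by (auto simp: p_def)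
  then have lp: "layer N p = m" by (simp add: layer_def)
  have pc: "p \<in> ternary_cube N"
    using mk kN by (auto simp: ternary_cube_def int_lattice_def p_def)
  have supp: "{n. g n \<noteq> 0} \<subseteq> ternary_cube N" by (auto simp: g_def layer_fun_def)
  show ?thesis
  proof (rule hardy_const_le_of_eigenfunction[where g = g and m = p])
    show "finite {n. g n \<noteq> 0}" using supp finite_ternary_cube by (rule finite_subset)
    show "{n. g n \<noteq> 0} \<subseteq> int_lattice N" using supp by (auto simp: ternary_cube_def)
    show "g lattice_zero = 0"
      by (simp add: g_def layer_fun_def layer_def lattice_zero_def a0)
    show "g p \<noteq> 0" using pc lp m by (simp add: g_def layer_fun_def)
    fix n assume gn: "g n \<noteq> 0"
    define l where "l = layer N n"
    have n: "n \<in> ternary_cube N" using gn supp by auto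
    have gl: "g n = a l" using n by (simp add: g_def layer_fun_def l_def)
    have l: "1 \<le> l" "l \<le> k" using a0 ak gn gl by (metis One_nat_def Suc_leI gr0I, metis not_le)
    have "card ({1..N} - {i \<in> {1..N}. n i \<noteq> 0}) = N - l"
      by (subst card_Diff_subset) (auto simp: l_def layer_def)
    moreover have "{1..N} - {i \<in> {1..N}. n i \<noteq> 0} = {i \<in> {1..N}. n i = 0}" by auto
    ultimately have z: "card {i \<in> {1..N}. n i = 0} = N - l" by simp
    have "(\<Sum>j\<in>{1..N}. g (lattice_add n (lattice_unit j)) + g (lattice_sub n (lattice_unit j)))
        = (\<Sum>j\<in>{1..N}. if n j = 0 then 2 * a (l + 1) else a (l - 1))"
      unfolding g_def l_def by (intro sum.cong refl layer_fun_neighbours n)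
    also have "\<dots> = 2 * (real N - real l) * a (l + 1) + real l * a (l - 1)"
      using z l kN by (simp add: sum.If_cases Int_def l_def layer_def algebra_simps of_nat_diff)
    finally have S: "(\<Sum>j\<in>{1..N}. g (lattice_add n (lattice_unit j)) + g (lattice_sub n (lattice_unit j)))
        = 2 * (real N - real l) * a (l + 1) + real l * a (l - 1)" .
    show "2 * real N * g n - (\<Sum>j\<in>{1..N}. g (lattice_add n (lattice_unit j))
                                   + g (lattice_sub n (lattice_unit j)))
       = x * (g n / (lattice_norm N n)\<^sup>2)"
      unfolding S lattice_norm_ternary[OF n] using eq[OF l] by (simp add: gl l_def)
  qed
qed

section \<open>From eigenvectors of the Ritz matrix to trial functions\<close>

text \<open>The three-term equation of the layers is not symmetric; conjugation by the diagonal matrix with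
  these entries turns it into the eigenvector equation of the Ritz matrix. Up to a constant factor
  the square of the entry is \<open>(N choose j) * 2 ^ j / j\<close>, the total Hardy weight of the points in
  layer \<open>j\<close>.\<close>
definition layer_scale :: "nat \<Rightarrow> nat \<Rightarrow> real" where
  "layer_scale N j = (\<Prod>i\<in>{1..<j}. sqrt (2 * real i * (real N - real i)) / (real i + 1))"

lemma layer_scale_Suc:
  assumes "1 \<le> j"
  shows "layer_scale N (Suc j) = layer_scale N j * (sqrt (2 * real j * (real N - real j)) / (real j + 1))"
  using assms by (simp add: layer_scale_def)

lemma layer_scale_pos:
  assumes "j \<le> N"
  shows "layer_scale N j > 0"
  unfolding layer_scale_def by (rule prod_pos) (use assms in auto)

lemma ritz_matrix_carrier: "ritz_matrix k N \<in> carrier_mat k k"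
  by (simp add: ritz_matrix_def)

text \<open>Dividing an eigenvector by the layer scale gives the values of a trial function on the layers.
  The bound holds for every eigenvalue, so it applies to the smallest one. The condition \<open>k \<le> N\<close>
  keeps the radicands of the off-diagonal entries nonnegative and the layers nonempty.\<close>
lemma hardy_const_le_ritz_eigenvalue:
  assumes ev: "eigenvalue (ritz_matrix k N) x" and kN: "k \<le> N"
  shows "hardy_const N \<le> x"
proof -
  let ?M = "ritz_matrix k N"
  obtain v where v: "v \<in> carrier_vec k" "v \<noteq> 0\<^sub>v k" "?M *\<^sub>v v = x \<cdot>\<^sub>v v"
    using ev by (auto simp: eigenvalue_def eigenvector_def ritz_matrix_def)
  \<comment> \<open>\<open>w\<close> is \<open>v\<close> counted from 1 and padded by zeros, so that the first and the last row need no separate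
    equation.\<close>
  define w where "w j = (if 1 \<le> j \<and> j \<le> k then v $ (j - 1) else 0)" for j
  define a where "a j = w j / layer_scale N j" for j
  have wa: "w j = layer_scale N j * a j" if "j \<le> k" for j
    using layer_scale_pos[of j N] that kN by (simp add: a_def)
  have row: "(\<Sum>c\<in>{1..k}. ritz_entry N j c * w c) = x * w j" if j: "1 \<le> j" "j \<le> k" for j
  proof -
    have "(?M *\<^sub>v v) $ (j - 1) = (\<Sum>c\<in>{0..<k}. ritz_entry N j (c + 1) * v $ c)"
      using j v(1) by (simp add: ritz_matrix_def scalar_prod_def)
    also have "\<dots> = (\<Sum>c\<in>{1..k}. ritz_entry N j c * w c)"
      by (rule sum.reindex_bij_witness[of _ "\<lambda>c. c - 1" Suc]) (auto simp: w_def)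
    finally show ?thesis using v j by (simp add: w_def)
  qed
  have three: "(\<Sum>c\<in>{1..k}. ritz_entry N j c * w c)
      = ritz_entry N j (j - 1) * w (j - 1) + ritz_entry N j j * w j + ritz_entry N j (j + 1) * w (j + 1)"
    if j: "1 \<le> j" "j \<le> k" for j
  proof -
    have "(\<Sum>c\<in>{1..k}. ritz_entry N j c * w c) = (\<Sum>c\<in>{j - 1, j, j + 1}. ritz_entry N j c * w c)"
      by (rule sum.mono_neutral_cong) (use j in \<open>auto simp: w_def ritz_entry_def\<close>)
    also have "\<dots> = ritz_entry N j (j - 1) * w (j - 1) + ritz_entry N j j * w j + ritz_entry N j (j + 1) * w (j + 1)"
      using j by (cases j) simp_all
    finally show ?thesis .
  qed
  obtain m where m: "m < k" "v $ m \<noteq> 0"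
    using v(1,2) by (auto simp: vec_eq_iff)
  show ?thesis
  proof (rule hardy_const_le_of_layer_eigenvector[OF kN, where a = a and m = "Suc m"])
    show "a 0 = 0" "\<And>j. j > k \<Longrightarrow> a j = 0" by (simp_all add: a_def w_def)
    show "a (Suc m) \<noteq> 0"
      using m kN layer_scale_pos[of "Suc m" N] by (simp add: a_def w_def)
  next
    fix j assume j: "1 \<le> j" "j \<le> k"
    define s where "s = layer_scale N j"
    have spos: "s > 0" using layer_scale_pos[of j N] j kN by (simp add: s_def)
    have E: "ritz_entry N j (j - 1) * w (j - 1) + ritz_entry N j j * w j
        + ritz_entry N j (j + 1) * w (j + 1) = x * w j"
      using row[OF j] three[OF j] by simp
    have up: "ritz_entry N j (j + 1) * w (j + 1) = - s * (2 * real j * (real N - real j) * a (j + 1))"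
    proof (cases "j < k")
      case True
      define r where "r = sqrt (2 * real j * (real N - real j))"
      have rr: "r * r = 2 * real j * (real N - real j)"
        using True kN by (simp add: r_def)
      have "w (j + 1) = s * (r / (real j + 1)) * a (j + 1)"
        using wa[of "j + 1"] True layer_scale_Suc[OF j(1), of N] by (simp add: s_def r_def)
      moreover have "ritz_entry N j (j + 1) = - (real j + 1) * r"
        by (simp add: ritz_entry_def ritz_offdiag_def r_def)
      ultimately have "ritz_entry N j (j + 1) * w (j + 1) = - s * (r * r * a (j + 1))"
        by (simp only:) (simp add: field_simps)
      then show ?thesis unfolding rr .
    next
      case False
      then show ?thesis by (simp add: a_def w_def)
    qed
    have dn: "ritz_entry N j (j - 1) * w (j - 1) = - s * (real j * real j * a (j - 1))"
    proof (cases "j = 1")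
      case True
      then show ?thesis by (simp add: a_def w_def)
    next
      case False
      then obtain i where i: "j = Suc i" "1 \<le> i" using j by (cases j) auto
      define q where "q = sqrt (2 * real i * (real N - real i))"
      have "s = layer_scale N i * (q / real j)"
        using layer_scale_Suc[OF i(2), of N] by (simp add: s_def q_def i)
      moreover have "w (j - 1) = layer_scale N i * a i"
        using wa[of i] j by (simp add: i)
      moreover have "ritz_entry N j (j - 1) = - real j * q"
        by (simp add: ritz_entry_def ritz_offdiag_def q_def i)
      ultimately show ?thesis
        using j by (simp only:) (simp add: i field_simps)
    qed
    have "s * (real j * (2 * real N * a j - real j * a (j - 1) - 2 * (real N - real j) * a (j + 1)))
        = s * (x * a j)"
      using E unfolding up dn using wa[OF j(2)]
      by (simp add: ritz_entry_def s_def algebra_simps)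
    then have "real j * (2 * real N * a j - real j * a (j - 1) - 2 * (real N - real j) * a (j + 1)) = x * a j"
      using spos by simp
    then show "2 * real N * a j - real j * a (j - 1) - 2 * (real N - real j) * a (j + 1) = x * (a j / real j)"
      using j by (simp add: field_simps)
  qed
qed

section \<open>Characteristic equations of order one, two and three\<close>

lemma det_2:
  fixes A :: "'a :: comm_ring_1 mat"
  assumes A: "A \<in> carrier_mat 2 2"
  shows "det A = A $$ (0,0) * A $$ (1,1) - A $$ (0,1) * A $$ (1,0)"
proof -
  have minor: "det (mat_delete A 0 j) = mat_delete A 0 j $$ (0,0)" for j
    using mat_delete_carrier[OF A, of 0 j] by (intro det_single) simp
  have "det A = (\<Sum>j<2. A $$ (0,j) * cofactor A 0 j)"
    by (rule laplace_expansion_row[OF A]) simp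
  then show ?thesis
    using A by (simp add: numeral_2_eq_2 cofactor_def minor) (simp add: mat_delete_def)
qed

lemma det_3:
  fixes A :: "'a :: comm_ring_1 mat"
  assumes A: "A \<in> carrier_mat 3 3"
  shows "det A = A $$ (0,0) * (A $$ (1,1) * A $$ (2,2) - A $$ (1,2) * A $$ (2,1))
    - A $$ (0,1) * (A $$ (1,0) * A $$ (2,2) - A $$ (1,2) * A $$ (2,0))
    + A $$ (0,2) * (A $$ (1,0) * A $$ (2,1) - A $$ (1,1) * A $$ (2,0))"
proof -
  have minor: "det (mat_delete A 0 j) = mat_delete A 0 j $$ (0,0) * mat_delete A 0 j $$ (1,1)
      - mat_delete A 0 j $$ (0,1) * mat_delete A 0 j $$ (1,0)" for j
    using mat_delete_carrier[OF A, of 0 j] by (intro det_2) simp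
  have "det A = (\<Sum>j<3. A $$ (0,j) * cofactor A 0 j)"
    by (rule laplace_expansion_row[OF A]) simp
  then show ?thesis
    using A by (simp add: numeral_3_eq_3 numeral_2_eq_2 cofactor_def minor) (simp add: mat_delete_def algebra_simps)
qed

lemma char_matrix_ritz:
  "i < k \<Longrightarrow> j < k \<Longrightarrow> char_matrix (ritz_matrix k N) x $$ (i, j)
     = ritz_entry N (i + 1) (j + 1) - (if i = j then x else 0)"
  by (simp add: char_matrix_def ritz_matrix_def)

lemma ritz_eigenvalue_1: "eigenvalue (ritz_matrix 1 N) x \<longleftrightarrow> x = 2 * real N"
proof -
  have "det (char_matrix (ritz_matrix 1 N) x) = 2 * real N - x"
    using char_matrix_closed[OF ritz_matrix_carrier[of 1 N], of x]
    by (simp add: det_single char_matrix_ritz ritz_entry_def)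
  then show ?thesis unfolding eigenvalue_det[OF ritz_matrix_carrier] by auto
qed

lemma ritz_eigenvalue_2:
  assumes "N \<ge> 1"
  shows "eigenvalue (ritz_matrix 2 N) x \<longleftrightarrow> (x - 3 * real N)\<^sup>2 = (real N)\<^sup>2 + 8 * real N - 8"
proof -
  have r: "sqrt (2 * real N - 2) * sqrt (2 * real N - 2) = 2 * real N - 2"
    using assms by simp
  have "det (char_matrix (ritz_matrix 2 N) x)
      = (2 * real N - x) * (4 * real N - x) - 4 * (sqrt (2 * real N - 2) * sqrt (2 * real N - 2))"
    using char_matrix_closed[OF ritz_matrix_carrier[of 2 N], of x]
    by (simp add: det_2 char_matrix_ritz ritz_entry_def ritz_offdiag_def algebra_simps)
  also have "\<dots> = (x - 3 * real N)\<^sup>2 - ((real N)\<^sup>2 + 8 * real N - 8)"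
    unfolding r by (simp add: power2_eq_square algebra_simps)
  finally show ?thesis unfolding eigenvalue_det[OF ritz_matrix_carrier] by simp
qed

lemma ritz_eigenvalue_3:
  assumes "N \<ge> 2"
  shows "eigenvalue (ritz_matrix 3 N) x \<longleftrightarrow> ritz_cubic N x = 0"
proof -
  have r: "sqrt (2 * real N - 2) * sqrt (2 * real N - 2) = 2 * real N - 2"
    and s: "sqrt (4 * real N - 8) * sqrt (4 * real N - 8) = 4 * real N - 8"
    using assms by simp_all
  have "det (char_matrix (ritz_matrix 3 N) x)
      = (2 * real N - x) * ((4 * real N - x) * (6 * real N - x)
             - 9 * (sqrt (4 * real N - 8) * sqrt (4 * real N - 8)))
        - 4 * (sqrt (2 * real N - 2) * sqrt (2 * real N - 2)) * (6 * real N - x)"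
    using char_matrix_closed[OF ritz_matrix_carrier[of 3 N], of x]
    by (simp add: det_3 char_matrix_ritz ritz_entry_def ritz_offdiag_def algebra_simps)
  also have "\<dots> = - ritz_cubic N x"
    unfolding r s by (simp add: ritz_cubic_def power2_eq_square power3_eq_cube algebra_simps)
  finally show ?thesis unfolding eigenvalue_det[OF ritz_matrix_carrier] by simp
qed

lemma finite_eigenvalues:
  assumes "A \<in> carrier_mat n n"
  shows "finite {x :: real. eigenvalue A x}"
proof -
  have "char_poly A \<noteq> 0" using degree_monic_char_poly[OF assms] by auto
  then show ?thesis
    unfolding eigenvalue_root_char_poly[OF assms] by (rule poly_roots_finite)
qed

lemma ritz_level_eqI:
  assumes "eigenvalue (ritz_matrix k N) x" "\<And>y. eigenvalue (ritz_matrix k N) y \<Longrightarrow> x \<le> y"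
  shows "ritz_level k N = x"
  unfolding ritz_level_def
  by (rule Min_eqI) (use assms finite_eigenvalues[OF ritz_matrix_carrier] in auto)

lemma ritz_level_1: "ritz_level 1 N = 2 * real N"
  by (rule ritz_level_eqI) (simp_all only: ritz_eigenvalue_1 order.refl)

lemma ritz_level_2_facts:
  assumes "N \<ge> 1"
  shows ritz_level_2: "ritz_level 2 N = 3 * real N - sqrt ((real N)\<^sup>2 + 8 * real N - 8)"
    and ritz_level_2_eigenvalue: "eigenvalue (ritz_matrix 2 N) (ritz_level 2 N)"
proof -
  let ?D = "(real N)\<^sup>2 + 8 * real N - 8"
  have "real N \<ge> 1" using assms by simp
  then have "?D \<ge> 0" using zero_le_power2[of "real N"] by linarith
  then have ev: "eigenvalue (ritz_matrix 2 N) (3 * real N - sqrt ?D)"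
    unfolding ritz_eigenvalue_2[OF assms] by simp
  have "3 * real N - sqrt ?D \<le> y" if "eigenvalue (ritz_matrix 2 N) y" for y
  proof -
    have "sqrt ?D = \<bar>y - 3 * real N\<bar>"
      using that unfolding ritz_eigenvalue_2[OF assms] by (metis real_sqrt_abs)
    then show ?thesis by linarith
  qed
  with ev show level: "ritz_level 2 N = 3 * real N - sqrt ?D" by (rule ritz_level_eqI)
  show "eigenvalue (ritz_matrix 2 N) (ritz_level 2 N)" unfolding level by (rule ev)
qed

section \<open>The trigonometric formula for the third level\<close>

text \<open>Put \<open>d = 2 * r * e\<close>. The equation says that the Chebyshev polynomial
  \<open>4 * e ^ 3 - 3 * e\<close> takes the same value at \<open>e\<close> and at \<open>cos \<theta>\<close>. The polynomial is strictly
  increasing on the half-line up to \<open>-1/2\<close>, and \<open>cos \<theta>\<close> lies there by the choice of the angle range.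
  So nothing to the left of \<open>cos \<theta>\<close> is a root.\<close>
lemma trig_cubic_smallest_root:
  fixes r \<theta> d :: real
  assumes r: "r > 0" and \<theta>: "2 * pi / 3 \<le> \<theta>" "\<theta> \<le> pi"
    and d: "d ^ 3 - 3 * r\<^sup>2 * d = 2 * r ^ 3 * cos (3 * \<theta>)"
  shows "2 * r * cos \<theta> \<le> d"
proof (rule ccontr)
  define c where "c = cos \<theta>"
  define e where "e = d / (2 * r)"
  assume "\<not> 2 * r * cos \<theta> \<le> d"
  then have ec: "e < c" using r by (simp add: e_def c_def field_simps)
  have "cos \<theta> \<le> cos (2 * pi / 3)"
    using \<theta> pi_ge_zero by (subst cos_mono_le_eq) auto
  then have c: "c \<le> - 1 / 2" by (simp add: c_def cos_120)
  have de: "d = 2 * r * e" using r by (simp add: e_def)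
  have "2 * r ^ 3 * (4 * e ^ 3 - 3 * e) = 2 * r ^ 3 * (4 * c ^ 3 - 3 * c)"
    using d unfolding de cos_treble_cos c_def[symmetric]
    by (simp add: power3_eq_cube power2_eq_square algebra_simps)
  then have "4 * e ^ 3 - 3 * e = 4 * c ^ 3 - 3 * c" using r by simp
  then have "(e - c) * (4 * (e * e + e * c + c * c) - 3) = 0"
    by (simp add: power3_eq_cube algebra_simps)
  then have 1: "4 * (e * e + e * c + c * c) = 3" using ec by simp
  have "(-e) * (-e) > 1 / 2 * (1 / 2)" by (rule mult_strict_mono) (use ec c in auto)
  moreover have "(-e) * (-c) \<ge> 1 / 2 * (1 / 2)" by (rule mult_mono) (use ec c in auto)
  moreover have "(-c) * (-c) \<ge> 1 / 2 * (1 / 2)" by (rule mult_mono) (use ec c in auto)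
  ultimately show False using 1 by simp
qed

lemma R_const_square:
  assumes "N \<ge> 2"
  shows "(R_const N)\<^sup>2 = (real N)\<^sup>2 + 11 * real N - 20"
proof -
  have "real N \<ge> 2" using assms by simp
  then have "(real N)\<^sup>2 + 11 * real N - 20 \<ge> 0" using zero_le_power2[of "real N"] by linarith
  then show ?thesis by (simp add: R_const_def)
qed

lemma R_const_ge:
  assumes "N \<ge> 2"
  shows "R_const N \<ge> real N"
  unfolding R_const_def using assms by (intro real_le_rsqrt) simp

lemma ritz_cubic_shift:
  assumes "N \<ge> 2"
  shows "ritz_cubic N (4 * real N + y)
    = y ^ 3 - 4 * (R_const N)\<^sup>2 * y - 8 * real N * (7 * real N - 16)"
  unfolding R_const_square[OF assms] ritz_cubic_def
  by (simp add: power3_eq_cube power2_eq_square algebra_simps)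

text \<open>The upper bound is the nonnegativity of the discriminant of the cubic. After squaring it becomes a
  polynomial inequality in \<open>N\<close>, and in the variable \<open>t = N - 3\<close> all coefficients of the difference
  are positive.\<close>
lemma phi_const_argument:
  assumes "N \<ge> 3"
  shows "0 \<le> 3 * sqrt 3 * real N * (7 * real N - 16) / (2 * R_const N ^ 3)"
    and "3 * sqrt 3 * real N * (7 * real N - 16) / (2 * R_const N ^ 3) \<le> 1"
proof -
  have R: "R_const N > 0" using R_const_ge[of N] assms by simp
  show "0 \<le> 3 * sqrt 3 * real N * (7 * real N - 16) / (2 * R_const N ^ 3)"
    using R assms by simp
  define t where "t = real N - 3"
  have t: "t \<ge> 0" "real N = t + 3" using assms by (auto simp: t_def)
  have "(3 * sqrt 3 * real N * (7 * real N - 16))\<^sup>2 = 27 * (real N)\<^sup>2 * (7 * real N - 16)\<^sup>2"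
    by (simp add: power_mult_distrib)
  also have "\<dots> \<le> 4 * ((real N)\<^sup>2 + 11 * real N - 20) ^ 3"
  proof -
    have "4 * ((real N)\<^sup>2 + 11 * real N - 20) ^ 3 - 27 * (real N)\<^sup>2 * (7 * real N - 16)\<^sup>2
      = 4 * t ^ 6 + 204 * t ^ 5 + 2409 * t ^ 4 + 18800 * t ^ 3 + 58182 * t ^ 2 + 77676 * t + 36517"
      unfolding t(2) by (simp add: eval_nat_numeral algebra_simps)
    also have "\<dots> \<ge> 0" using t(1) by simp
    finally show ?thesis by simp
  qed
  also have "\<dots> = (2 * R_const N ^ 3)\<^sup>2"
  proof -
    have "(2 * R_const N ^ 3)\<^sup>2 = 4 * ((R_const N)\<^sup>2) ^ 3"
      by (simp add: power_mult_distrib flip: power_mult)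
    then show ?thesis using R_const_square[of N] assms by simp
  qed
  finally have "3 * sqrt 3 * real N * (7 * real N - 16) \<le> 2 * R_const N ^ 3"
    by (rule power2_le_imp_le) (use R in simp)
  then show "3 * sqrt 3 * real N * (7 * real N - 16) / (2 * R_const N ^ 3) \<le> 1"
    by (subst divide_le_eq_1_pos) (use R in simp_all)
qed

text \<open>In the variable \<open>y = x - 4 * N\<close> the cubic has no square term, and with \<open>3 * r\<^sup>2 = 4 * R\<^sup>2\<close> it
  takes the form solved by the triple angle formula. Since \<open>\<theta> = phi_const N + 2 * pi / 3\<close> lies between
  \<open>2 * pi / 3\<close> and \<open>pi\<close>, it gives the smallest root. The bound \<open>3 * N\<close> is crude, but it is
  what the estimate of the secant slope in the asymptotic expansion needs.\<close>
lemma ritz_level_3_facts: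
  assumes N: "N \<ge> 3"
  defines "\<theta> \<equiv> phi_const N + 2 * pi / 3"
  shows ritz_level_3: "ritz_level 3 N = 4 * real N + 4 * R_const N / sqrt 3 * cos \<theta>"
    and ritz_level_3_upper: "ritz_level 3 N \<le> 3 * real N"
    and ritz_level_3_root: "ritz_cubic N (ritz_level 3 N) = 0"
    and ritz_level_3_least: "\<And>x. ritz_cubic N x = 0 \<Longrightarrow> ritz_level 3 N \<le> x"
proof -
  define R where "R = R_const N"
  define r where "r = 2 * R / sqrt 3"
  define t where "t = 3 * sqrt 3 * real N * (7 * real N - 16) / (2 * R ^ 3)"
  have RN: "R \<ge> real N" using R_const_ge[of N] N by (simp add: R_def)
  then have R: "R > 0" using N by simp
  then have r: "r > 0" by (simp add: r_def)
  have t: "0 \<le> t" "t \<le> 1"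
    using phi_const_argument[OF N] by (simp_all add: t_def R_def)
  have phi: "phi_const N = arccos t / 3" by (simp add: phi_const_def t_def R_def)
  have "0 \<le> arccos t" "arccos t \<le> pi"
    using t by (auto intro: arccos_lbound arccos_ubound)
  then have \<theta>: "2 * pi / 3 \<le> \<theta>" "\<theta> \<le> pi"
    by (simp_all add: \<theta>_def phi)
  have "cos (3 * \<theta>) = cos (arccos t + 2 * pi)"
    by (simp add: \<theta>_def phi algebra_simps)
  also have "\<dots> = t" using t by (simp add: cos_arccos)
  finally have cos3: "cos (3 * \<theta>) = t" .
  have r2: "3 * r\<^sup>2 = 4 * R\<^sup>2" by (simp add: r_def power_divide power_mult_distrib)
  have "r ^ 3 = 8 * R ^ 3 / (sqrt 3 ^ 3)" by (simp add: r_def power_divide power_mult_distrib)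
  also have "sqrt 3 ^ 3 = 3 * sqrt 3" by (simp add: power3_eq_cube)
  finally have r3: "2 * r ^ 3 * t = 8 * real N * (7 * real N - 16)"
    using R by (simp add: t_def)
  have cubic: "ritz_cubic N (4 * real N + y) = 0 \<longleftrightarrow> y ^ 3 - 3 * r\<^sup>2 * y = 2 * r ^ 3 * cos (3 * \<theta>)" for y
    using ritz_cubic_shift[of N y] N unfolding cos3 r3 r2 R_def by auto
  have root: "ritz_cubic N (4 * real N + 2 * r * cos \<theta>) = 0"
    unfolding cubic cos_treble_cos by (simp add: power3_eq_cube power2_eq_square algebra_simps)
  have least: "4 * real N + 2 * r * cos \<theta> \<le> x" if "ritz_cubic N x = 0" for x
    using trig_cubic_smallest_root[OF r \<theta>, of "x - 4 * real N"] cubic[of "x - 4 * real N"] that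
    by simp
  have level: "ritz_level 3 N = 4 * real N + 2 * r * cos \<theta>"
    by (rule ritz_level_eqI) (use root least ritz_eigenvalue_3[of N] N in auto)
  show "ritz_level 3 N = 4 * real N + 4 * R_const N / sqrt 3 * cos \<theta>"
    by (simp add: level r_def R_def)
  show "ritz_cubic N (ritz_level 3 N) = 0" unfolding level by (rule root)
  show "ritz_level 3 N \<le> x" if "ritz_cubic N x = 0" for x
    unfolding level by (rule least[OF that])
  have "sqrt 3 \<le> 2" by (rule real_le_lsqrt) simp_all
  then have "r \<ge> R" using R by (simp add: r_def field_simps)
  have "cos \<theta> \<le> cos (2 * pi / 3)"
    using \<theta> pi_ge_zero by (subst cos_mono_le_eq) auto
  then have "cos \<theta> \<le> - 1 / 2" by (simp add: cos_120)
  then have "2 * r * cos \<theta> \<le> 2 * r * (- 1 / 2)" using r by (intro mult_left_mono) auto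
  then show "ritz_level 3 N \<le> 3 * real N"
    using \<open>r \<ge> R\<close> RN by (simp add: level)
qed

section \<open>Comparison of the levels\<close>

lemma ritz_level_2_less:
  assumes "N \<ge> 2"
  shows "ritz_level 2 N < 2 * real N"
proof -
  have "real N < sqrt ((real N)\<^sup>2 + 8 * real N - 8)"
    using assms by (intro real_less_rsqrt) simp
  then show ?thesis using assms by (simp add: ritz_level_2)
qed

lemma twice_less_A_const:
  assumes "N \<ge> 12"
  shows "2 * real N < A_const N"
proof -
  have "(real N - 12) * real N \<ge> 0" using assms by simp
  then show ?thesis by (simp add: A_const_def power2_eq_square algebra_simps)
qed

lemma ritz_level_2_less_A_const:
  assumes "N \<ge> 11"
  shows "ritz_level 2 N < A_const N"
proof (cases "N = 11")
  case True
  have "sqrt 201 > 14" by (rule real_less_rsqrt) simp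
  then show ?thesis by (simp add: True ritz_level_2 A_const_def)
next
  case False
  then show ?thesis using ritz_level_2_less[of N] twice_less_A_const[of N] assms by simp
qed

lemma ritz_level_2_10: "ritz_level 2 10 > A_const 10"
proof -
  have "sqrt 172 < 14" by (rule real_less_lsqrt) simp_all
  then show ?thesis by (simp add: ritz_level_2 A_const_def)
qed

lemma ritz_level_3_10: "ritz_level 3 10 < A_const 10"
proof -
  \<comment> \<open>\<open>A_const 10 = 16\<close>, and the cubic changes sign between 0 and 16.\<close>
  have "\<exists>x\<ge>0. x \<le> 16 \<and> ritz_cubic 10 x = 0"
    by (rule IVT) (auto simp: ritz_cubic_def)
  then obtain x where x: "x \<le> 16" "ritz_cubic 10 x = 0" by blast
  moreover have "ritz_cubic 10 16 \<noteq> 0" by (simp add: ritz_cubic_def)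
  ultimately have "x < 16" by (cases "x = 16") auto
  then show ?thesis
    using ritz_level_3_least[of 10 x] x by (simp add: A_const_def)
qed

section \<open>Asymptotic expansion of the third level\<close>

lemma ritz_cubic_diff:
  "ritz_cubic N (4 * real N + y) - ritz_cubic N (4 * real N + z)
     = (y - z) * (y\<^sup>2 + y * z + z\<^sup>2 - 4 * ((real N)\<^sup>2 + 11 * real N - 20))"
  unfolding ritz_cubic_def by (simp add: power3_eq_cube power2_eq_square algebra_simps)

definition ritz_3_approx :: "nat \<Rightarrow> real" where
  "ritz_3_approx N = 2 * real N - 4 - 6 / real N + 51 / (real N)\<^sup>2"

text \<open>The terms of the expansion are those that make the cubic cancel up to order \<open>1 / N\<close>. Near
  \<open>2 * N\<close> the slope of the cubic is of order \<open>N\<^sup>2\<close>, so a residual of this size is an error of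
  order \<open>1 / N ^ 3\<close> in the root.\<close>
lemma ritz_cubic_approx: "(\<lambda>N. ritz_cubic N (ritz_3_approx N)) \<in> O(\<lambda>N. 1 / real N)"
  unfolding ritz_cubic_def ritz_3_approx_def by real_asymp

text \<open>The slope is bounded from below by the secant factor \<open>Q\<close> of \<open>ritz_cubic_diff\<close>. In the shifted
  variable the root is at most \<open>-N\<close> and the approximation eventually at most \<open>-2 * N\<close>; so the
  quadratic form in \<open>Q\<close> is at least \<open>7 * N\<^sup>2\<close>, whereas the subtracted term is eventually at most
  \<open>5 * N\<^sup>2\<close>.\<close>
lemma ritz_level_3_asymp:
  "(\<lambda>N. ritz_level 3 N - ritz_3_approx N) \<in> O(\<lambda>N. 1 / real N ^ 3)"
proof -
  obtain c where c: "c > 0" "\<forall>\<^sub>F N in sequentially. norm (ritz_cubic N (ritz_3_approx N)) \<le> c * norm (1 / real N)"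
    using ritz_cubic_approx by (rule landau_o.bigE)
  have g: "\<forall>\<^sub>F N in sequentially. ritz_3_approx N \<le> 2 * real N"
    unfolding ritz_3_approx_def by real_asymp
  have q: "\<forall>\<^sub>F N in sequentially. 4 * ((real N)\<^sup>2 + 11 * real N - 20) \<le> 5 * (real N)\<^sup>2"
    by real_asymp
  have "\<forall>\<^sub>F N in sequentially. norm (ritz_level 3 N - ritz_3_approx N) \<le> c * norm (1 / real N ^ 3)"
    using c(2) g q eventually_ge_at_top[of 3]
  proof eventually_elim
    case (elim N)
    define n where "n = real N"
    define y where "y = ritz_level 3 N - 4 * n"
    define z where "z = ritz_3_approx N - 4 * n"
    define Q where "Q = y\<^sup>2 + y * z + z\<^sup>2 - 4 * (n\<^sup>2 + 11 * n - 20)"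
    have n: "n > 0" using elim(4) by (simp add: n_def)
    have y: "-y \<ge> n" using ritz_level_3_upper[OF elim(4)] by (simp add: y_def n_def)
    have z: "-z \<ge> 2 * n" using elim(2) by (simp add: z_def n_def)
    have "(-y) * (-y) \<ge> n * n" "(-y) * (-z) \<ge> n * (2 * n)" "(-z) * (-z) \<ge> (2 * n) * (2 * n)"
      using y z n by (intro mult_mono; simp)+
    then have "n\<^sup>2 \<le> y\<^sup>2" "2 * n\<^sup>2 \<le> y * z" "4 * n\<^sup>2 \<le> z\<^sup>2"
      by (simp_all add: power2_eq_square algebra_simps)
    then have Q: "Q \<ge> n\<^sup>2"
      using elim(3) zero_le_power2[of n] unfolding Q_def n_def by linarith
    have "ritz_cubic N (ritz_3_approx N) = - ((y - z) * Q)"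
      using ritz_cubic_diff[of N y z] ritz_level_3_root[OF elim(4)]
      by (simp add: y_def z_def n_def Q_def)
    then have "\<bar>y - z\<bar> * \<bar>Q\<bar> \<le> c / n"
      using elim(1) n by (simp add: abs_mult n_def)
    moreover have "\<bar>y - z\<bar> * n\<^sup>2 \<le> \<bar>y - z\<bar> * \<bar>Q\<bar>"
      using Q by (intro mult_left_mono) auto
    ultimately have "\<bar>y - z\<bar> * n\<^sup>2 \<le> c / n" by linarith
    then have "\<bar>y - z\<bar> \<le> c / n ^ 3"
      using n by (simp add: field_simps power3_eq_cube power2_eq_square)
    then show ?case using n by (simp add: y_def z_def n_def)
  qed
  then show ?thesis by (rule bigoI)
qed

theorem proposition5p4:
  shows "(\<forall>N\<ge>3.
            ritz_level 1 N = 2 * real N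
          \<and> ritz_level 2 N = 3 * real N - sqrt ((real N)\<^sup>2 + 8 * real N - 8)
          \<and> ritz_level 3 N
              = 4 * real N + 4 * R_const N / sqrt 3 * cos (phi_const N + 2 * pi / 3)
          \<and> ritz_cubic N (ritz_level 3 N) = 0
          \<and> (\<forall>x. ritz_cubic N x = 0 \<longrightarrow> ritz_level 3 N \<le> x)
          \<and> ritz_level 2 N < 2 * real N)
       \<and> (\<forall>N\<ge>12. ritz_level 1 N < A_const N)
       \<and> ritz_level 2 10 > A_const 10
       \<and> (\<forall>N\<ge>11. ritz_level 2 N < A_const N)
       \<and> ritz_level 3 10 < A_const 10
       \<and> (\<forall>N\<ge>11. hardy_const N \<le> ritz_level 2 N
                  \<and> ritz_level 2 N < min (A_const N) (2 * real N))
       \<and> hardy_const 10 < A_const 10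
       \<and> (\<lambda>N. ritz_level 3 N - (2 * real N - 4 - 6 / real N + 51 / (real N)\<^sup>2))
            \<in> O(\<lambda>N. 1 / real N ^ 3)"
proof (intro conjI allI impI)
  fix N :: nat assume N: "N \<ge> 3"
  show "ritz_level 1 N = 2 * real N" by (rule ritz_level_1)
  show "ritz_level 2 N = 3 * real N - sqrt ((real N)\<^sup>2 + 8 * real N - 8)"
    using N by (simp add: ritz_level_2)
  show "ritz_level 3 N = 4 * real N + 4 * R_const N / sqrt 3 * cos (phi_const N + 2 * pi / 3)"
    by (rule ritz_level_3[OF N])
  show "ritz_cubic N (ritz_level 3 N) = 0" by (rule ritz_level_3_root[OF N])
  show "ritz_level 3 N \<le> x" if "ritz_cubic N x = 0" for x
    by (rule ritz_level_3_least[OF N that])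
  show "ritz_level 2 N < 2 * real N" using N by (simp add: ritz_level_2_less)
next
  show "ritz_level 1 N < A_const N" if "N \<ge> 12" for N
    unfolding ritz_level_1 by (rule twice_less_A_const[OF that])
next
  show "ritz_level 2 10 > A_const 10" by (rule ritz_level_2_10)
next
  fix N :: nat assume N: "N \<ge> 11"
  show less_A: "ritz_level 2 N < A_const N" by (rule ritz_level_2_less_A_const[OF N])
  show "hardy_const N \<le> ritz_level 2 N"
    using hardy_const_le_ritz_eigenvalue[OF ritz_level_2_eigenvalue] N by simp
  show "ritz_level 2 N < min (A_const N) (2 * real N)"
    using less_A N by (simp add: ritz_level_2_less)
next
  show "ritz_level 3 10 < A_const 10" by (rule ritz_level_3_10)
  have "hardy_const 10 \<le> ritz_level 3 10"
    using hardy_const_le_ritz_eigenvalue[of 3 10] ritz_eigenvalue_3[of 10] ritz_level_3_root[of 10]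
    by simp
  then show "hardy_const 10 < A_const 10" using ritz_level_3_10 by linarith
next
  show "(\<lambda>N. ritz_level 3 N - (2 * real N - 4 - 6 / real N + 51 / (real N)\<^sup>2))
            \<in> O(\<lambda>N. 1 / real N ^ 3)"
    using ritz_level_3_asymp by (simp add: ritz_3_approx_def)
qed

end
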